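(* Let $a>0$ and let $\sigma_1,\sigma_2\in\mathbb{C}\setminus\{0,-1\}$. Let $$\mathbb{P}=\frac12\begin{pmatrix}1&1/a\\ a&1\end{pmatrix},\qquad X=\begin{pmatrix}1&0\\0&-1\end{pmatrix},$$ and let $J_2$ be the block Jacobi iteration matrix $$J_2=\begin{pmatrix}(1+\sigma_1)\mathrm{I}-\mathbb{P}&0\\0&(1+\sigma_2)\mathrm{I}-\mathbb{P}\end{pmatrix}^{-1}\begin{pmatrix}0&\sigma_1X\\ \sigma_2X&0\end{pmatrix}\in\mathbb{C}^{4\times4}.$$ Then the spectrum of $J_2$ is $$\sigma(J_2)=\left\{-\sqrt{\frac{\sigma_1}{\sigma_1+1}},\ \sqrt{\frac{\sigma_1}{\sigma_1+1}},\ -\sqrt{\frac{\sigma_2}{\sigma_2+1}},\ \sqrt{\frac{\sigma_2}{\sigma_2+1}}\right\}.$$ In particular the spectrum does not depend on $a$.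
   Context: $\mathrm{I}$ is the $2\times2$ identity matrix. For complex $z$, $\pm\sqrt z$ denotes the two complex square roots of $z$. The matrix $\mathbb{P}$ is the Calderón projector (the same for both half-lines $\mathbb{R}_-$ and $\mathbb{R}_+$) associated with the equation $-u''+a^2u=0$, and $J_2$ is the block Jacobi iteration matrix of the two-subdomain multitrace formulation $(\mathrm{I}-\mathbb{P})U_1+\sigma_1(U_1-XU_2)=F_1$, $(\mathrm{I}-\mathbb{P})U_2+\sigma_2(U_2-XU_1)=F_2$ with unknowns $U_1,U_2\in\mathbb{C}^2$. *)

theory Defs
  imports "Jordan_Normal_Form.Gauss_Jordan_Elimination" "Jordan_Normal_Form.Spectral_Radius"
begin

definition calderon_proj :: "real \<Rightarrow> complex mat" where
  "calderon_proj a = (1 / 2) \<cdot>\<^sub>m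
     mat_of_rows_list 2 [[1, 1 / complex_of_real a],
                         [complex_of_real a, 1]]"

definition X_mat :: "complex mat" where
  "X_mat = mat_of_rows_list 2 [[1, 0], [0, -1]]"

definition jacobi_diag :: "real \<Rightarrow> complex \<Rightarrow> complex \<Rightarrow> complex mat" where
  "jacobi_diag a \<sigma>1 \<sigma>2 =
     four_block_mat ((1 + \<sigma>1) \<cdot>\<^sub>m 1\<^sub>m 2 - calderon_proj a) (0\<^sub>m 2 2)
                    (0\<^sub>m 2 2) ((1 + \<sigma>2) \<cdot>\<^sub>m 1\<^sub>m 2 - calderon_proj a)"

definition jacobi_offdiag :: "complex \<Rightarrow> complex \<Rightarrow> complex mat" where
  "jacobi_offdiag \<sigma>1 \<sigma>2 =
     four_block_mat (0\<^sub>m 2 2) (\<sigma>1 \<cdot>\<^sub>m X_mat)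
                    (\<sigma>2 \<cdot>\<^sub>m X_mat) (0\<^sub>m 2 2)"

(* mat_inverse returns None on singular matrices, so this is the intended matrix only
   when jacobi_diag is invertible. *)
definition J2 :: "real \<Rightarrow> complex \<Rightarrow> complex \<Rightarrow> complex mat" where
  "J2 a \<sigma>1 \<sigma>2 = the (mat_inverse (jacobi_diag a \<sigma>1 \<sigma>2)) * jacobi_offdiag \<sigma>1 \<sigma>2"

end

theory Submission
  imports Defs
begin

text \<open>
  Since \<open>P\<close> is a projector, \<open>((1 + s) I - P)\<inverse> = (s I + P) / (s (1 + s))\<close>, so that \<open>J\<^sub>2\<close> is block
  off-diagonal with blocks \<open>A\<^sub>i = (s\<^sub>i I + P) X / (1 + s\<^sub>i)\<close>. Conjugation by \<open>X\<close> exchanges \<open>P\<close> with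
  \<open>I - P\<close>, hence \<open>A\<^sub>1 A\<^sub>2 = (s\<^sub>1 I + P) (s\<^sub>2 I + I - P) / ((1 + s\<^sub>1) (1 + s\<^sub>2))\<close>. This acts as
  \<open>s\<^sub>2 / (1 + s\<^sub>2)\<close> on the range of \<open>P\<close> and as \<open>s\<^sub>1 / (1 + s\<^sub>1)\<close> on its kernel, and the eigenvalues
  of \<open>J\<^sub>2\<close> are the square roots of the eigenvalues of \<open>A\<^sub>1 A\<^sub>2\<close>.
\<close>

lemma mat_of_rows_list_2_carrier [simp]: "mat_of_rows_list 2 [[p, q], [r, s]] \<in> carrier_mat 2 2"
  by (simp add: mat_of_rows_list_def numeral_2_eq_2)

lemma mult_mat_of_rows_list_2:
  fixes p q r s p' q' r' s' :: "'a :: comm_semiring_0"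
  shows "mat_of_rows_list 2 [[p, q], [r, s]] * mat_of_rows_list 2 [[p', q'], [r', s']] =
    mat_of_rows_list 2 [[p * p' + q * r', p * q' + q * s'], [r * p' + s * r', r * q' + s * s']]"
  by (rule eq_matI) (auto simp: scalar_prod_def mat_of_rows_list_def less_Suc_eq less_2_cases_iff)

lemma minus_mat_of_rows_list_2:
  fixes p q r s p' q' r' s' :: "'a :: ab_group_add"
  shows "mat_of_rows_list 2 [[p, q], [r, s]] - mat_of_rows_list 2 [[p', q'], [r', s']] =
    mat_of_rows_list 2 [[p - p', q - q'], [r - r', s - s']]"
  by (rule eq_matI) (auto simp: mat_of_rows_list_def less_Suc_eq less_2_cases_iff)

lemma smult_mat_of_rows_list_2:
  fixes p q r s k :: "'a :: comm_semiring_0"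
  shows "k \<cdot>\<^sub>m mat_of_rows_list 2 [[p, q], [r, s]] =
    mat_of_rows_list 2 [[k * p, k * q], [k * r, k * s]]"
  by (rule eq_matI) (auto simp: mat_of_rows_list_def less_Suc_eq less_2_cases_iff)

lemma one_mat_2: "(1\<^sub>m 2 :: 'a :: zero_neq_one mat) = mat_of_rows_list 2 [[1, 0], [0, 1]]"
  by (rule eq_matI) (auto simp: mat_of_rows_list_def less_Suc_eq less_2_cases_iff)

lemma mat_of_rows_list_2_eqI:
  assumes "p = p'" "q = q'" "r = r'" "s = s'"
  shows "mat_of_rows_list 2 [[p, q], [r, s]] = mat_of_rows_list 2 [[p', q'], [r', s']]"
  using assms by simp

lemmas mat_2_simps = mult_mat_of_rows_list_2 minus_mat_of_rows_list_2
  smult_mat_of_rows_list_2 one_mat_2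

text \<open>The four entries are read as commuting 1 by 1 blocks, so the block determinant formula
  applies.\<close>

lemma det_mat_of_rows_list_2:
  fixes p q r s :: "'a :: idom"
  shows "det (mat_of_rows_list 2 [[p, q], [r, s]]) = p * s - q * r"
proof -
  have "mat_of_rows_list 2 [[p, q], [r, s]] =
    four_block_mat (mat 1 1 (\<lambda>_. p)) (mat 1 1 (\<lambda>_. q)) (mat 1 1 (\<lambda>_. r)) (mat 1 1 (\<lambda>_. s))"
    by (rule eq_matI) (auto simp: mat_of_rows_list_def less_Suc_eq less_2_cases_iff)
  also have "det \<dots> = det (mat 1 1 (\<lambda>_. p) * mat 1 1 (\<lambda>_. s) - mat 1 1 (\<lambda>_. q) * mat 1 1 (\<lambda>_. r))"
    by (rule det_four_block_mat) (auto simp: scalar_prod_def mult.commute intro!: eq_matI)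
  also have "\<dots> = p * s - q * r"
    by (subst det_single) (auto simp: scalar_prod_def)
  finally show ?thesis .
qed

text \<open>Over a field a one-sided inverse of a square matrix is two-sided. So \<open>A\<close> is
  a unit of the matrix ring, which excludes \<open>None\<close>, and uniqueness of inverses
  identifies the result with \<open>B\<close>.\<close>

lemma the_mat_inverse:
  fixes A B :: "'a :: field mat"
  assumes A: "A \<in> carrier_mat n n" and B: "B \<in> carrier_mat n n" and AB: "A * B = 1\<^sub>m n"
  shows "the (mat_inverse A) = B"
proof -
  have BA: "B * A = 1\<^sub>m n"
    using mat_mult_left_right_inverse[OF A B AB] .
  have "A \<in> Units (ring_mat TYPE('a) n ())"
    using A B AB BA unfolding Units_def ring_mat_def by auto
  then obtain C where C: "mat_inverse A = Some C"
    using mat_inverse(1)[OF A, of "()"] by (cases "mat_inverse A") auto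
  have CA: "C * A = 1\<^sub>m n" and C_carrier: "C \<in> carrier_mat n n"
    using mat_inverse(2)[OF A C] by auto
  have "C = C * (A * B)"
    using AB C_carrier by simp
  also have "\<dots> = B"
    using A B C_carrier CA assoc_mult_mat[of C n n A n B n] by simp
  finally show ?thesis
    using C by simp
qed

text \<open>The characteristic matrix has scalar diagonal blocks, which commute with
  \<open>A\<close> and \<open>B\<close>, so its determinant collapses to one of half the
  size.\<close>

lemma spectrum_block_offdiag:
  fixes A B :: "'a :: field mat"
  assumes A: "A \<in> carrier_mat n n" and B: "B \<in> carrier_mat n n"
  shows "spectrum (four_block_mat (0\<^sub>m n n) A B (0\<^sub>m n n)) =
    {k. det ((k * k) \<cdot>\<^sub>m 1\<^sub>m n - A * B) = 0}"
proof -
  let ?M = "four_block_mat (0\<^sub>m n n) A B (0\<^sub>m n n)"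
  have M: "?M \<in> carrier_mat (n + n) (n + n)"
    using A B by auto
  have "det (char_matrix ?M k) = det ((k * k) \<cdot>\<^sub>m 1\<^sub>m n - A * B)" for k
  proof -
    let ?K = "(- k) \<cdot>\<^sub>m 1\<^sub>m n :: 'a mat"
    have "char_matrix ?M k = four_block_mat ?K A B ?K"
      using A B by (intro eq_matI) (auto simp: char_matrix_def)
    also have "det \<dots> = det (?K * ?K - A * B)"
      using A B by (intro det_four_block_mat) auto
    also have "?K * ?K = (k * k) \<cdot>\<^sub>m 1\<^sub>m n"
      by (intro eq_matI) auto
    finally show ?thesis .
  qed
  then show ?thesis
    unfolding spectrum_def eigenvalue_det[OF M, abs_def] by auto
qed

lemma four_block_carrier_4:
  assumes "A \<in> carrier_mat 2 2" "D \<in> carrier_mat 2 2"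
  shows "four_block_mat A B C D \<in> carrier_mat 4 4"
  using four_block_carrier_mat[OF assms] by simp

lemma X_mat_carrier [simp]: "X_mat \<in> carrier_mat 2 2"
  by (simp add: X_mat_def)

lemma calderon_proj_eq:
  "calderon_proj a = mat_of_rows_list 2
    [[1 / 2, 1 / (2 * complex_of_real a)], [complex_of_real a / 2, 1 / 2]]"
  by (simp add: calderon_proj_def smult_mat_of_rows_list_2)

lemma calderon_proj_carrier [simp]: "calderon_proj a \<in> carrier_mat 2 2"
  by (simp add: calderon_proj_eq)

text \<open>The entries of \<open>(s I + P) / (s (1 + s))\<close>.\<close>

definition calderon_resolvent :: "real \<Rightarrow> complex \<Rightarrow> complex mat" where
  "calderon_resolvent a s = mat_of_rows_list 2
    [[(s + 1 / 2) / (s * (1 + s)), 1 / (2 * complex_of_real a) / (s * (1 + s))],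
     [complex_of_real a / 2 / (s * (1 + s)), (s + 1 / 2) / (s * (1 + s))]]"

lemma calderon_resolvent_carrier [simp]: "calderon_resolvent a s \<in> carrier_mat 2 2"
  by (simp add: calderon_resolvent_def)

lemma calderon_resolvent_inverse:
  assumes "a > 0" "s \<noteq> 0" "1 + s \<noteq> 0"
  shows "((1 + s) \<cdot>\<^sub>m 1\<^sub>m 2 - calderon_proj a) * calderon_resolvent a s = 1\<^sub>m 2"
proof -
  have "a \<noteq> 0"
    using assms(1) by simp
  then show ?thesis
    using assms(2,3) unfolding calderon_proj_eq calderon_resolvent_def mat_2_simps
    by (intro mat_of_rows_list_2_eqI) (simp_all add: divide_simps, simp_all add: algebra_simps)
qed

lemma jacobi_diag_carrier [simp]: "jacobi_diag a s1 s2 \<in> carrier_mat 4 4"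
  unfolding jacobi_diag_def by (intro four_block_carrier_4 minus_carrier_mat) auto

lemma jacobi_diag_inverse:
  assumes "a > 0" "s1 \<notin> {0, -1}" "s2 \<notin> {0, -1}"
  shows "jacobi_diag a s1 s2 * four_block_mat (calderon_resolvent a s1) (0\<^sub>m 2 2)
    (0\<^sub>m 2 2) (calderon_resolvent a s2) = 1\<^sub>m 4"
proof -
  have "1 + s1 \<noteq> 0" "1 + s2 \<noteq> 0"
    using assms by (auto simp: add_eq_0_iff)
  moreover have "(1 + s) \<cdot>\<^sub>m 1\<^sub>m 2 - calderon_proj a \<in> carrier_mat 2 2" for s
    by (intro minus_carrier_mat) simp
  ultimately show ?thesis
    using assms four_block_one_mat[of 2 2, where 'a = complex] unfolding jacobi_diag_def
    by (subst mult_four_block_mat[of _ 2 2 _ 2 _ 2 _ _ 2 _ 2])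
      (simp_all add: calderon_resolvent_inverse left_mult_zero_mat[of _ 2 2] right_mult_zero_mat[of _ 2 2])
qed

lemma J2_eq:
  assumes "a > 0" "s1 \<notin> {0, -1}" "s2 \<notin> {0, -1}"
  shows "J2 a s1 s2 = four_block_mat (0\<^sub>m 2 2) (calderon_resolvent a s1 * (s1 \<cdot>\<^sub>m X_mat))
    (calderon_resolvent a s2 * (s2 \<cdot>\<^sub>m X_mat)) (0\<^sub>m 2 2)"
proof -
  let ?B = "four_block_mat (calderon_resolvent a s1) (0\<^sub>m 2 2) (0\<^sub>m 2 2) (calderon_resolvent a s2)"
  have "?B \<in> carrier_mat 4 4"
    by (intro four_block_carrier_4) auto
  then have "the (mat_inverse (jacobi_diag a s1 s2)) = ?B"
    using assms by (intro the_mat_inverse[of _ 4] jacobi_diag_inverse) auto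
  then show ?thesis
    unfolding J2_def jacobi_offdiag_def
    by (simp, subst mult_four_block_mat[of _ 2 2 _ 2 _ 2 _ _ 2 _ 2])
      (simp_all add: left_mult_zero_mat[of _ 2 2] right_mult_zero_mat[of _ 2 2]
        mult_carrier_mat[of _ 2 2])
qed

text \<open>The product has equal diagonal entries m and off-diagonal entries with product q^2, so
  the determinant is (z - m)^2 - q^2 = (z - m - q) (z - m + q). Here m =
  \<open>1 - e s1 - e s2\<close> and q = \<open>e s1 - e s2\<close>.\<close>

lemma det_offdiag_product:
  assumes a: "a > 0" and s1: "s1 \<noteq> 0" "1 + s1 \<noteq> 0" and s2: "s2 \<noteq> 0" "1 + s2 \<noteq> 0"
  shows "det (z \<cdot>\<^sub>m 1\<^sub>m 2 - calderon_resolvent a s1 * (s1 \<cdot>\<^sub>m X_mat) *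
      (calderon_resolvent a s2 * (s2 \<cdot>\<^sub>m X_mat))) = (z - s1 / (1 + s1)) * (z - s2 / (1 + s2))"
\<comment> \<open>The parameter \<open>a\<close> enters only through \<open>c * d = 1\<close>. The
  choice of \<open>e\<close> makes all block entries and the target eigenvalues affine in
  \<open>e s\<close>, leaving polynomial identities.\<close>
proof -
  define c d where "c = complex_of_real a" and "d = inverse c"
  define e where "e s = 1 / (2 * (1 + s))" for s :: complex
  have cd: "c * d = 1"
    using a by (simp add: c_def d_def)
  have block: "calderon_resolvent a s * (s \<cdot>\<^sub>m X_mat) =
      mat_of_rows_list 2 [[1 - e s, - (d * e s)], [c * e s, - (1 - e s)]]"
    and frac: "s / (1 + s) = 1 - 2 * e s"
    if "s \<noteq> 0" "1 + s \<noteq> 0" for s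
  proof -
    \<comment> \<open>With \<open>u\<close> in place of \<open>1 + s\<close> every denominator is a
      product of atoms known to be nonzero.\<close>
    define u where "u = 1 + s"
    have s: "s = u - 1" "u \<noteq> 0" "u \<noteq> 1"
      using that by (auto simp: u_def)
    show "calderon_resolvent a s * (s \<cdot>\<^sub>m X_mat) =
        mat_of_rows_list 2 [[1 - e s, - (d * e s)], [c * e s, - (1 - e s)]]"
      using s(2,3) a
      unfolding calderon_resolvent_def X_mat_def mat_2_simps c_def d_def e_def
        u_def [symmetric] s(1)
      by (intro mat_of_rows_list_2_eqI) (auto simp: field_simps)
    show "s / (1 + s) = 1 - 2 * e s"
      using s(2) unfolding e_def u_def [symmetric] s(1) by (simp add: field_simps)
  qed
  have product: "calderon_resolvent a s1 * (s1 \<cdot>\<^sub>m X_mat) * (calderon_resolvent a s2 * (s2 \<cdot>\<^sub>m X_mat)) =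
      mat_of_rows_list 2 [[1 - e s1 - e s2, d * (e s1 - e s2)], [c * (e s1 - e s2), 1 - e s1 - e s2]]"
    unfolding block[OF s1] block[OF s2] mat_2_simps
  proof (intro mat_of_rows_list_2_eqI)
    have "c * d * (e s1 * e s2) = e s1 * e s2"
      by (simp add: cd)
    then show "(1 - e s1) * (1 - e s2) + - (d * e s1) * (c * e s2) = 1 - e s1 - e s2"
      and "c * e s1 * - (d * e s2) + - (1 - e s1) * - (1 - e s2) = 1 - e s1 - e s2"
      by (simp_all add: algebra_simps)
  qed (simp_all add: algebra_simps)
  \<comment> \<open>This is the product of the off-diagonal entries; \<open>a\<close> cancels from
    the determinant here.\<close>
  have "c * d * (e s1 - e s2)\<^sup>2 = (e s1 - e s2)\<^sup>2"
    by (simp add: cd)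
  then show ?thesis
    unfolding product mat_2_simps det_mat_of_rows_list_2 frac[OF s1] frac[OF s2]
    by (simp add: algebra_simps power2_eq_square)
qed

text \<open>As both signs occur, the branch chosen by \<open>csqrt\<close> is immaterial.\<close>

lemma square_eq_iff_csqrt: "k * k = w \<longleftrightarrow> k = csqrt w \<or> k = - csqrt w"
  by (metis csqrt_square minus_mult_minus power2_csqrt power2_eq_square square_eq_iff)

lemma spectrum_J2:
  assumes "a > 0" "s1 \<notin> {0, -1}" "s2 \<notin> {0, -1}"
  shows "spectrum (J2 a s1 s2) =
    {- csqrt (s1 / (s1 + 1)), csqrt (s1 / (s1 + 1)),
     - csqrt (s2 / (s2 + 1)), csqrt (s2 / (s2 + 1))}"
proof -
  have nz: "s1 \<noteq> 0" "1 + s1 \<noteq> 0" "s2 \<noteq> 0" "1 + s2 \<noteq> 0"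
    using assms by (auto simp: add_eq_0_iff)
  \<comment> \<open>The factored determinant is taken at \<open>z = k * k\<close>.\<close>
  have "spectrum (J2 a s1 s2) =
    {k. (k * k - s1 / (1 + s1)) * (k * k - s2 / (1 + s2)) = 0}"
    unfolding J2_eq[OF assms]
    using nz assms(1)
    by (subst spectrum_block_offdiag[of _ 2]) (auto simp: det_offdiag_product intro!: mult_carrier_mat[of _ 2 2])
  then show ?thesis
    by (auto simp: square_eq_iff_csqrt add.commute)
qed

theorem mainTheorem1:
  fixes a :: real and \<sigma>1 \<sigma>2 :: complex
  assumes "a > 0"
    and "\<sigma>1 \<notin> {0, -1}" and "\<sigma>2 \<notin> {0, -1}"
  shows "invertible_mat (jacobi_diag a \<sigma>1 \<sigma>2)
    \<and> spectrum (J2 a \<sigma>1 \<sigma>2) =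
        {- csqrt (\<sigma>1 / (\<sigma>1 + 1)), csqrt (\<sigma>1 / (\<sigma>1 + 1)),
         - csqrt (\<sigma>2 / (\<sigma>2 + 1)), csqrt (\<sigma>2 / (\<sigma>2 + 1))}
    \<and> (\<forall>b>0. spectrum (J2 b \<sigma>1 \<sigma>2) = spectrum (J2 a \<sigma>1 \<sigma>2))"
proof -
  let ?D = "jacobi_diag a \<sigma>1 \<sigma>2"
  let ?B = "four_block_mat (calderon_resolvent a \<sigma>1) (0\<^sub>m 2 2) (0\<^sub>m 2 2) (calderon_resolvent a \<sigma>2)"
  have D: "?D \<in> carrier_mat 4 4" and B: "?B \<in> carrier_mat 4 4"
    by (auto intro: four_block_carrier_4)
  have DB: "?D * ?B = 1\<^sub>m 4"
    using assms by (rule jacobi_diag_inverse)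
  \<comment> \<open>\<open>invertible_mat\<close> asks for an inverse on both sides.\<close>
  have "?B * ?D = 1\<^sub>m 4"
    using mat_mult_left_right_inverse[OF D B DB] .
  then have "invertible_mat ?D"
    using D B DB unfolding invertible_mat_def inverts_mat_def by (metis carrier_matD square_mat.simps)
  \<comment> \<open>The right-hand side of \<open>spectrum_J2\<close> does not contain
    \<open>a\<close>, so using it for \<open>b\<close> as well gives the independence.\<close>
  then show ?thesis
    using spectrum_J2[OF _ assms(2,3)] assms(1) by simp
qed

end
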